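(* Let $S=\begin{pmatrix}a&b\\c&d\end{pmatrix}$ and $T=\begin{pmatrix}\lambda&\eta\\0&\mu\end{pmatrix}$ in $\mathrm{SL}(2,\mathbb H)$, where $\Re\lambda=\Re\mu$ and $|\lambda|\le1\le|\mu|$, generate a discrete, non-elementary subgroup of $\mathrm{SL}(2,\mathbb H)$. Put $$\tau_0=\lambda(-c^{-1}d)+\eta+(c^{-1}d)\mu,\qquad t_0=\lambda(ac^{-1})+\eta-(ac^{-1})\mu ,$$ and assume $\tau_0t_0\neq0$. If $$\frac{|\tau_0-t_0|}{|\tau_0t_0|}>|\overline c d+a\overline c|,$$ then $\langle S,T\rangle$ is not extreme.
   Context: $\mathbb H$ is the division ring of real quaternions. For $q=q_0+q_1i+q_2j+q_3k\in\mathbb H$ ($q_0,\dots,q_3\in\mathbb R$): $\Re q=q_0$, $\Im q=q_1i+q_2j+q_3k$ (a quaternion), $\overline q=\Re q-\Im q$, $|q|=\sqrt{q_0^2+q_1^2+q_2^2+q_3^2}$. For a $2\times2$ quaternionic matrix $A=\begin{pmatrix}a&b\\c&d\end{pmatrix}$, $\det A=\sqrt{|a|^2|d|^2+|b|^2|c|^2-2\Re(a\overline c d\overline b)}$ (which equals $|ad-aca^{-1}b|$ when $a\ne0$); $\mathrm{SL}(2,\mathbb H)$ is the group of such matrices with $\det=1$. It acts on $\widehat{\mathbb H}=\mathbb H\cup\{\infty\}$ by $Z\mapsto(aZ+b)(cZ+d)^{-1}$, and by Poincaré extension on hyperbolic 5-space $\mathbf H^5$ (with boundary $\widehat{\mathbb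 H}$) by orientation-preserving isometries. A subgroup is elementary if it has a finite orbit in $\mathbf H^5\cup\widehat{\mathbb H}$, and non-elementary otherwise. (Since $T$ fixes $\infty$, non-elementarity of $\langle S,T\rangle$ forces $c\ne0$.) Let $S(\lambda,\mu)=|\mu|(|\Im\lambda|+|\Im\mu|)$, and let $\epsilon=\frac1{4\sqrt2}$ if $\Re\lambda=\Re\mu\neq0$, $\epsilon=\frac14$ if $\Re\lambda=\Re\mu=0$. A discrete non-elementary group $\langle S,T\rangle$ with $S=\begin{pmatrix}a&b\\c&d\end{pmatrix}$ and $T=\begin{pmatrix}\lambda&\eta\\0&\mu\end{pmatrix}$ in $\mathrm{SL}(2,\mathbb H)$, $\Re\lambda=\Re\mu$, $|\lambda|\le1\le|\mu|$, is called extreme if $S(\lambda,\mu)\le\epsilon$ and equality holds in the Jørgensen-type inequality $|c|\sqrt{|\tau_0||t_0|}\ge\frac{1+\sqrt{1-\epsilon^{-1}S(\lambda,\mu)}}{2}$, i.e. $|c|\sqrt{|\tau_0||t_0|}=\frac{1+\sqrt{1-\epsilon^{-1}S(\lambda,\mu)}}{2}$, where $\tau_0=\lambda(-c^{-1}d)+\eta+(c^{-1}d)\mu$ and $t_0=\lambda(ac^{-1})+\eta-(ac^{-1})\mu$. *)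

theory Defs
  imports "HOL-Analysis.Analysis" "HOL-Algebra.Generated_Groups"
begin

section \<open>Real quaternions\<close>

datatype quat = Quat (qre: real) (qi: real) (qj: real) (qk: real)

lemma quat_eq_iff: "x = y \<longleftrightarrow> qre x = qre y \<and> qi x = qi y \<and> qj x = qj y \<and> qk x = qk y"
  by (cases x; cases y) auto

instantiation quat :: real_vector
begin

definition "0 = Quat 0 0 0 0"
definition "x + y = Quat (qre x + qre y) (qi x + qi y) (qj x + qj y) (qk x + qk y)"
definition "- x = Quat (- qre x) (- qi x) (- qj x) (- qk x)"
definition "x - y = Quat (qre x - qre y) (qi x - qi y) (qj x - qj y) (qk x - qk y)"
definition "scaleR r x = Quat (r * qre x) (r * qi x) (r * qj x) (r * qk x)"

lemma quat_additive_simps [simp]: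
  "qre 0 = 0" "qi 0 = 0" "qj 0 = 0" "qk 0 = 0"
  "qre (x + y) = qre x + qre y" "qi (x + y) = qi x + qi y"
  "qj (x + y) = qj x + qj y" "qk (x + y) = qk x + qk y"
  "qre (- x) = - qre x" "qi (- x) = - qi x" "qj (- x) = - qj x" "qk (- x) = - qk x"
  "qre (x - y) = qre x - qre y" "qi (x - y) = qi x - qi y"
  "qj (x - y) = qj x - qj y" "qk (x - y) = qk x - qk y"
  "qre (scaleR r x) = r * qre x" "qi (scaleR r x) = r * qi x"
  "qj (scaleR r x) = r * qj x" "qk (scaleR r x) = r * qk x"
  by (simp_all add: zero_quat_def plus_quat_def uminus_quat_def minus_quat_def scaleR_quat_def)

instance
  by standard (simp_all add: quat_eq_iff algebra_simps)

end

instantiation quat :: real_algebra_1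
begin

definition "1 = Quat 1 0 0 0"
definition "x * y = Quat
  (qre x * qre y - qi x * qi y - qj x * qj y - qk x * qk y)
  (qre x * qi y + qi x * qre y + qj x * qk y - qk x * qj y)
  (qre x * qj y - qi x * qk y + qj x * qre y + qk x * qi y)
  (qre x * qk y + qi x * qj y - qj x * qi y + qk x * qre y)"

lemma quat_mult_simps [simp]:
  "qre 1 = 1" "qi 1 = 0" "qj 1 = 0" "qk 1 = 0"
  "qre (x * y) = qre x * qre y - qi x * qi y - qj x * qj y - qk x * qk y"
  "qi (x * y) = qre x * qi y + qi x * qre y + qj x * qk y - qk x * qj y"
  "qj (x * y) = qre x * qj y - qi x * qk y + qj x * qre y + qk x * qi y"
  "qk (x * y) = qre x * qk y + qi x * qj y - qj x * qi y + qk x * qre y"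
  by (simp_all add: one_quat_def times_quat_def)

instance
  by standard (simp_all add: quat_eq_iff algebra_simps)

end

lemma quat_sumsq_eq_0:
  "(qre x)\<^sup>2 + (qi x)\<^sup>2 + (qj x)\<^sup>2 + (qk x)\<^sup>2 = 0 \<longleftrightarrow> x = 0"
  by (simp add: quat_eq_iff add_nonneg_eq_0_iff)

definition qcnj :: "quat \<Rightarrow> quat" where
  "qcnj q = Quat (qre q) (- qi q) (- qj q) (- qk q)"

definition qim :: "quat \<Rightarrow> quat" where
  "qim q = Quat 0 (qi q) (qj q) (qk q)"

lemma qcnj_simps [simp]:
  "qre (qcnj q) = qre q" "qi (qcnj q) = - qi q" "qj (qcnj q) = - qj q" "qk (qcnj q) = - qk q"
  by (simp_all add: qcnj_def)

lemma qim_simps [simp]: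
  "qre (qim q) = 0" "qi (qim q) = qi q" "qj (qim q) = qj q" "qk (qim q) = qk q"
  by (simp_all add: qim_def)

instantiation quat :: real_div_algebra
begin

definition "inverse x =
  scaleR (1 / ((qre x)\<^sup>2 + (qi x)\<^sup>2 + (qj x)\<^sup>2 + (qk x)\<^sup>2)) (qcnj x)"
definition "x div y = x * inverse (y :: quat)"

instance
proof
  fix x y :: quat
  {
    fix x :: quat assume "x \<noteq> 0"
    define N where "N = (qre x)\<^sup>2 + (qi x)\<^sup>2 + (qj x)\<^sup>2 + (qk x)\<^sup>2"
    have "N \<noteq> 0" using \<open>x \<noteq> 0\<close> quat_sumsq_eq_0 [of x] by (simp add: N_def)
    moreover have "qcnj x * x = scaleR N 1" "x * qcnj x = scaleR N 1"
      by (simp_all add: quat_eq_iff N_def power2_eq_square)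
    moreover have "inverse x = scaleR (1 / N) (qcnj x)"
      by (simp add: inverse_quat_def N_def)
    ultimately have "inverse x * x = 1" "x * inverse x = 1" by simp_all
  }
  then show "x \<noteq> 0 \<Longrightarrow> inverse x * x = 1" and "x \<noteq> 0 \<Longrightarrow> x * inverse x = 1"
    by auto
  show "x div y = x * inverse y" by (rule divide_quat_def)
  show "inverse (0 :: quat) = 0" by (simp add: inverse_quat_def quat_eq_iff)
qed

end

instantiation quat :: real_inner
begin

definition "inner x y = qre x * qre y + qi x * qi y + qj x * qj y + qk x * qk y"
definition "norm x = sqrt ((qre x)\<^sup>2 + (qi x)\<^sup>2 + (qj x)\<^sup>2 + (qk x)\<^sup>2)"
definition "sgn x = (x :: quat) /\<^sub>R norm x"
definition "dist x y = norm (x - y :: quat)"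
definition [code del]:
  "(uniformity :: (quat \<times> quat) filter) = (INF e\<in>{0 <..}. principal {(x, y). dist x y < e})"
definition [code del]:
  "open (U :: quat set) \<longleftrightarrow> (\<forall>x\<in>U. eventually (\<lambda>(x', y). x' = x \<longrightarrow> y \<in> U) uniformity)"

instance
proof
  fix x y z :: quat and r :: real
  show "inner x x = 0 \<longleftrightarrow> x = 0"
    using quat_sumsq_eq_0 [of x] by (simp add: inner_quat_def power2_eq_square)
qed (simp_all add: inner_quat_def norm_quat_def sgn_quat_def dist_quat_def
      uniformity_quat_def open_quat_def power2_eq_square algebra_simps)

end

instance quat :: real_normed_div_algebra
proof
  fix x y :: quat
  show "norm (x * y) = norm x * norm y"
    by (simp add: norm_quat_def real_sqrt_mult [symmetric] power2_eq_square algebra_simps)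
qed


section \<open>The group SL(2,H)\<close>

definition mat2 :: "quat \<Rightarrow> quat \<Rightarrow> quat \<Rightarrow> quat \<Rightarrow> quat^2^2" where
  "mat2 a b c d = vector [vector [a, b], vector [c, d]]"

lemma mat2_nth [simp]:
  "mat2 a b c d $ 1 $ 1 = a" "mat2 a b c d $ 1 $ 2 = b"
  "mat2 a b c d $ 2 $ 1 = c" "mat2 a b c d $ 2 $ 2 = d"
  by (simp_all add: mat2_def)

definition qdet :: "quat^2^2 \<Rightarrow> real" where
  "qdet A = (let a = A$1$1; b = A$1$2; c = A$2$1; d = A$2$2 in
     sqrt ((norm a)\<^sup>2 * (norm d)\<^sup>2 + (norm b)\<^sup>2 * (norm c)\<^sup>2
           - 2 * qre (a * qcnj c * d * qcnj b)))"

definition SL2H :: "(quat^2^2) monoid" where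
  "SL2H = \<lparr>carrier = {A. qdet A = 1}, mult = (**), one = mat 1\<rparr>"

text \<open>
  \<^const>\<open>SL2H\<close> is a group, so that \<^const>\<open>generate\<close> yields the generated subgroup.
  The expression under the root in \<^const>\<open>qdet\<close> is the Gram determinant of the two rows.
\<close>

definition qgram :: "quat \<Rightarrow> quat \<Rightarrow> quat \<Rightarrow> quat \<Rightarrow> real" where
  "qgram a b c d = (norm a)\<^sup>2 * (norm d)\<^sup>2 + (norm b)\<^sup>2 * (norm c)\<^sup>2
     - 2 * qre (a * qcnj c * d * qcnj b)"

lemma norm_quat_sq: "(norm x)\<^sup>2 = (qre x)\<^sup>2 + (qi x)\<^sup>2 + (qj x)\<^sup>2 + (qk x)\<^sup>2"
  by (simp add: norm_quat_def)

lemma qdet_eq_1_iff: "qdet A = 1 \<longleftrightarrow> qgram (A$1$1) (A$1$2) (A$2$1) (A$2$2) = 1"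
  by (simp add: qdet_def Let_def qgram_def)

lemma norm_qcnj [simp]: "norm (qcnj x) = norm x"
  by (simp add: norm_quat_def)

lemma norm_sq_add: "(norm (x + y))\<^sup>2 = (norm x)\<^sup>2 + (norm y)\<^sup>2 + 2 * inner x y" for x y :: quat
  by (simp add: power2_norm_eq_inner inner_add_left inner_add_right inner_commute)

lemma inner_qcnj_right: "inner x (y * z) = inner (x * qcnj z) y"
  by (simp add: inner_quat_def algebra_simps)

lemma qgram_eq:
  "qgram a b c d = ((norm a)\<^sup>2 + (norm b)\<^sup>2) * ((norm c)\<^sup>2 + (norm d)\<^sup>2)
     - (norm (a * qcnj c + b * qcnj d))\<^sup>2"
proof -
  have re: "qre (u * v) = inner u (qcnj v)" for u v
    by (simp add: inner_quat_def)
  have "qcnj (d * qcnj b) = b * qcnj d"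
    by (simp add: quat_eq_iff)
  then have "qre (a * qcnj c * (d * qcnj b)) = inner (a * qcnj c) (b * qcnj d)"
    by (simp only: re)
  then have "qre (a * qcnj c * d * qcnj b) = inner (a * qcnj c) (b * qcnj d)"
    by (simp only: mult.assoc)
  then show ?thesis
    by (simp only: qgram_def norm_sq_add norm_mult norm_qcnj power_mult_distrib)
       (simp add: algebra_simps)
qed

lemma qgram_swap: "qgram c d a b = qgram a b c d"
proof -
  have "c * qcnj a + d * qcnj b = qcnj (a * qcnj c + b * qcnj d)"
    by (simp add: quat_eq_iff)
  then show ?thesis
    by (simp only: qgram_eq norm_qcnj mult.commute)
qed

lemma qgram_add_row: "qgram (a + x * c) (b + x * d) c d = qgram a b c d"
proof -
  define R where "R = (norm c)\<^sup>2 + (norm d)\<^sup>2"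
  define p where "p = a * qcnj c + b * qcnj d"
  have N: "z * qcnj z = (norm z)\<^sup>2 *\<^sub>R 1" for z
    by (simp add: quat_eq_iff norm_quat_sq) (simp add: power2_eq_square)
  have "(a + x * c) * qcnj c + (b + x * d) * qcnj d = p + (x * (c * qcnj c) + x * (d * qcnj d))"
    by (simp only: p_def distrib_right mult.assoc add_ac)
  also have "\<dots> = p + R *\<^sub>R x"
    by (simp add: N R_def scaleR_add_left)
  finally have 1: "(norm ((a + x * c) * qcnj c + (b + x * d) * qcnj d))\<^sup>2
      = (norm p)\<^sup>2 + R\<^sup>2 * (norm x)\<^sup>2 + 2 * R * inner p x"
    by (simp add: norm_sq_add power_mult_distrib)
  have 2: "(norm (a + x * c))\<^sup>2 + (norm (b + x * d))\<^sup>2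
      = (norm a)\<^sup>2 + (norm b)\<^sup>2 + (norm x)\<^sup>2 * R + 2 * inner p x"
    by (simp add: norm_sq_add inner_qcnj_right norm_mult power_mult_distrib R_def p_def
        inner_add_left distrib_left)
  show ?thesis
    unfolding qgram_eq 1 2 R_def [symmetric] p_def [symmetric]
    by (simp add: power2_eq_square algebra_simps)
qed

lemma qgram_scale_row: "qgram (u * a) (u * b) c d = (norm u)\<^sup>2 * qgram a b c d"
proof -
  have "u * a * qcnj c + u * b * qcnj d = u * (a * qcnj c + b * qcnj d)"
    by (simp only: distrib_left mult.assoc)
  then show ?thesis
    by (simp only: qgram_eq norm_mult power_mult_distrib) (simp add: algebra_simps)
qed

lemma qgram_triangular:
  "qgram a b 0 d = (norm a)\<^sup>2 * (norm d)\<^sup>2" "qgram 0 b c d = (norm b)\<^sup>2 * (norm c)\<^sup>2"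
  by (simp_all add: qgram_def)

lemma qgram_mult:
  "qgram (a * p + b * r) (a * q + b * s) (c * p + d * r) (c * q + d * s)
     = qgram a b c d * qgram p q r s" (is "?L = _")
proof (cases "a = 0")
  case False
  define x where "x = - (c * inverse a)"
  define t where "t = d + x * b"
  have 1: "c + x * a = 0" using False by (simp add: x_def mult.assoc)
  have c: "c = - (x * a)" using 1 by (simp add: eq_neg_iff_add_eq_0)
  have "?L = qgram (c * p + d * r) (c * q + d * s) (a * p + b * r) (a * q + b * s)"
    by (rule qgram_swap)
  also have "\<dots> = qgram (c * p + d * r + x * (a * p + b * r)) (c * q + d * s + x * (a * q + b * s))
      (a * p + b * r) (a * q + b * s)"
    by (rule qgram_add_row [symmetric])
  also have "\<dots> = qgram (t * r) (t * s) (a * p + b * r) (a * q + b * s)"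
    by (simp add: c t_def algebra_simps)
  also have "\<dots> = (norm t)\<^sup>2 * qgram r s (a * p + b * r) (a * q + b * s)"
    by (rule qgram_scale_row)
  also have "\<dots> = (norm t)\<^sup>2 * ((norm a)\<^sup>2 * qgram p q r s)"
    by (simp add: qgram_swap [of r s] qgram_add_row qgram_scale_row)
  also have "\<dots> = qgram a b 0 t * qgram p q r s" by (simp add: qgram_triangular)
  also have "qgram a b 0 t = qgram (c + x * a) (d + x * b) a b"
    by (simp add: 1 t_def qgram_swap)
  also have "\<dots> = qgram a b c d"
    by (simp only: qgram_add_row, rule qgram_swap)
  finally show ?thesis .
next
  case True
  have "?L = (norm b)\<^sup>2 * qgram r s (c * p + d * r) (c * q + d * s)"
    by (simp add: True qgram_scale_row)
  also have "\<dots> = (norm b)\<^sup>2 * ((norm c)\<^sup>2 * qgram p q r s)"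
    by (simp add: qgram_swap [of r s] qgram_add_row qgram_scale_row)
  finally show ?thesis by (simp add: True qgram_triangular)
qed

lemma quat_mat_eq_iff: "A = B \<longleftrightarrow> A$1$1 = B$1$1 \<and> A$1$2 = B$1$2 \<and> A$2$1 = B$2$1 \<and> A$2$2 = B$2$2"
  for A B :: "quat^2^2"
  by (auto simp: vec_eq_iff forall_2)

lemma quat_mat_mult_nth: "(A ** B) $ i $ j = A$i$1 * B$1$j + A$i$2 * B$2$j" for A B :: "quat^2^2"
  by (simp add: matrix_matrix_mult_def sum_2)

lemma quat_mat_left_inverse_ex:
  fixes A :: "quat^2^2"
  assumes "qdet A = 1"
  shows "\<exists>B. B ** A = mat 1"
proof -
  obtain a b c d where A: "A = mat2 a b c d"
    by (metis quat_mat_eq_iff mat2_nth)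
  have g: "qgram a b c d = 1" using assms by (simp add: qdet_eq_1_iff A)
  show ?thesis
  proof (cases "a = 0")
    case True
    then have "b \<noteq> 0" "c \<noteq> 0" using g by (auto simp: qgram_triangular)
    then have "mat2 (- (inverse c * d * inverse b)) (inverse c) (inverse b) 0 ** A = mat 1"
      by (simp add: A True quat_mat_eq_iff quat_mat_mult_nth mat_def mult.assoc)
    then show ?thesis ..
  next
    case False
    define x where "x = c * inverse a"
    define t where "t = d - x * b"
    have c: "c = x * a" using False by (simp add: x_def mult.assoc)
    have d: "d = t + x * b" by (simp add: t_def)
    have "qgram a b c d = qgram (0 + x * a) (t + x * b) a b"
      by (simp add: c d qgram_swap)
    also have "\<dots> = (norm t)\<^sup>2 * (norm a)\<^sup>2"
      by (simp only: qgram_add_row qgram_triangular)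
    finally have "t \<noteq> 0" using g by auto
    define u where "u = inverse t"
    have u: "u * t = 1" "u * (t * z) = z" for z
      using \<open>t \<noteq> 0\<close> by (simp_all add: u_def mult.assoc [symmetric])
    define v where "v = inverse a"
    have v: "v * a = 1" using False by (simp add: v_def)
    have "mat2 (v + v * b * u * x) (- (v * b * u)) (- (u * x)) u ** A = mat 1"
      by (simp add: A c d quat_mat_eq_iff quat_mat_mult_nth mat_def u v algebra_simps)
    then show ?thesis ..
  qed
qed

lemma group_SL2H: "group SL2H"
proof (rule groupI)
  have qdet_mult: "qdet (A ** B) = 1" if "qdet A = 1" "qdet B = 1" for A B
    using that by (simp add: qdet_eq_1_iff quat_mat_mult_nth qgram_mult)
  have qdet_one: "qdet (mat 1) = 1"
    by (simp add: qdet_eq_1_iff mat_def qgram_triangular)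
  show "\<one>\<^bsub>SL2H\<^esub> \<in> carrier SL2H" by (simp add: SL2H_def qdet_one)
  fix A B C
  assume A: "A \<in> carrier SL2H"
  obtain A' where A': "A' ** A = mat 1"
    using A quat_mat_left_inverse_ex by (auto simp: SL2H_def)
  have "qgram (A'$1$1) (A'$1$2) (A'$2$1) (A'$2$2) * qgram (A$1$1) (A$1$2) (A$2$1) (A$2$2) = 1"
    using A' qdet_one by (simp add: qdet_eq_1_iff qgram_mult [symmetric] quat_mat_mult_nth [symmetric])
  then have "qdet A' = 1" using A by (simp add: SL2H_def qdet_eq_1_iff)
  then show "\<exists>A'\<in>carrier SL2H. A' \<otimes>\<^bsub>SL2H\<^esub> A = \<one>\<^bsub>SL2H\<^esub>"
    using A' by (auto simp: SL2H_def)
  show "\<one>\<^bsub>SL2H\<^esub> \<otimes>\<^bsub>SL2H\<^esub> A = A" by (simp add: SL2H_def)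
  assume B: "B \<in> carrier SL2H"
  show "A \<otimes>\<^bsub>SL2H\<^esub> B \<in> carrier SL2H" using A B qdet_mult by (simp add: SL2H_def)
  show "A \<otimes>\<^bsub>SL2H\<^esub> B \<otimes>\<^bsub>SL2H\<^esub> C = A \<otimes>\<^bsub>SL2H\<^esub> (B \<otimes>\<^bsub>SL2H\<^esub> C)"
    by (simp add: SL2H_def matrix_mul_assoc)
qed


section \<open>Action on the closed hyperbolic 5-space\<close>

datatype qhat = Fin quat | Infty

definition mobius :: "quat^2^2 \<Rightarrow> qhat \<Rightarrow> qhat" where
  "mobius A P = (let a = A$1$1; b = A$1$2; c = A$2$1; d = A$2$2 in
     case P of
       Fin Z \<Rightarrow> if c * Z + d = 0 then Infty else Fin ((a * Z + b) * inverse (c * Z + d))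
     | Infty \<Rightarrow> if c = 0 then Infty else Fin (a * inverse c))"

text \<open>
  Hyperbolic 5-space in the upper half-space model: a point is a pair \<open>(Z, t)\<close> of a quaternion
  and a height \<open>t > 0\<close>.
\<close>

definition H5 :: "(quat \<times> real) set" where
  "H5 = {(Z, t). 0 < t}"

text \<open>
  The Poincare extension in coordinates.  It is the usual formula for Moebius maps of
  determinant 1: translations act by \<open>(Z + b, t)\<close>, diagonal matrices by
  \<open>(a Z d\<inverse>, t / |d|\<^sup>2)\<close>, and \<open>Z \<mapsto> Z\<inverse>\<close> extends to
  \<open>(qcnj Z, t) / (|Z|\<^sup>2 + t\<^sup>2)\<close>; at \<open>t = 0\<close> it gives back \<^const>\<open>mobius\<close>.
\<close>

definition poincare_ext :: "quat^2^2 \<Rightarrow> quat \<times> real \<Rightarrow> quat \<times> real" where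
  "poincare_ext A p = (let a = A$1$1; b = A$1$2; c = A$2$1; d = A$2$2; Z = fst p; t = snd p;
       D = (norm (c * Z + d))\<^sup>2 + (norm c)\<^sup>2 * t\<^sup>2 in
     (((a * Z + b) * qcnj (c * Z + d) + t\<^sup>2 *\<^sub>R (a * qcnj c)) /\<^sub>R D, t / D))"

lemma poincare_ext_boundary:
  assumes "A$2$1 * Z + A$2$2 \<noteq> 0"
  shows "poincare_ext A (Z, 0) = (W, 0) \<longleftrightarrow> mobius A (Fin Z) = Fin W"
proof -
  have "inverse w = qcnj w /\<^sub>R (norm w)\<^sup>2" for w :: quat
    by (simp add: inverse_quat_def norm_quat_sq divide_inverse)
  with assms show ?thesis by (simp add: poincare_ext_def mobius_def Let_def)
qed

lemma poincare_ext_H5: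
  assumes "A \<in> carrier SL2H" "p \<in> H5"
  shows "poincare_ext A p \<in> H5"
proof -
  obtain Z t where p: "p = (Z, t)" "0 < t" using assms(2) by (auto simp: H5_def)
  define D where "D = (norm (A$2$1 * Z + A$2$2))\<^sup>2 + (norm (A$2$1))\<^sup>2 * t\<^sup>2"
  have "A$2$1 \<noteq> 0 \<or> A$2$2 \<noteq> 0"
    using assms(1) by (auto simp: SL2H_def qdet_def Let_def)
  then have "0 < D"
    using p by (cases "A$2$1 = 0") (auto simp: D_def intro!: add_nonneg_pos)
  then show ?thesis using p by (simp add: poincare_ext_def Let_def H5_def D_def)
qed

definition elementary :: "(quat^2^2) set \<Rightarrow> bool" where
  "elementary G \<longleftrightarrow>
     (\<exists>p\<in>H5. finite ((\<lambda>A. poincare_ext A p) ` G)) \<or> (\<exists>P. finite ((\<lambda>A. mobius A P) ` G))"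


section \<open>Extreme groups\<close>

definition S_fun :: "quat \<Rightarrow> quat \<Rightarrow> real" where
  "S_fun l m = norm m * (norm (qim l) + norm (qim m))"

text \<open>Used only for \<open>qre l = qre m\<close>, so the case distinction can be made on \<open>l\<close> alone.\<close>

definition eps :: "quat \<Rightarrow> real" where
  "eps l = (if qre l = 0 then 1 / 4 else 1 / (4 * sqrt 2))"

definition tau_0 :: "quat^2^2 \<Rightarrow> quat^2^2 \<Rightarrow> quat" where
  "tau_0 S T = (let c = S$2$1; d = S$2$2; l = T$1$1; h = T$1$2; m = T$2$2 in
     l * (- (inverse c * d)) + h + (inverse c * d) * m)"

definition t_0 :: "quat^2^2 \<Rightarrow> quat^2^2 \<Rightarrow> quat" where
  "t_0 S T = (let a = S$1$1; c = S$2$1; l = T$1$1; h = T$1$2; m = T$2$2 in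
     l * (a * inverse c) + h - (a * inverse c) * m)"

text \<open>
  Discreteness is with respect to the product topology of the four entries.
  Being extreme is a property of the generating pair.
\<close>

definition extreme :: "quat^2^2 \<Rightarrow> quat^2^2 \<Rightarrow> bool" where
  "extreme S T \<longleftrightarrow>
     (let G = generate SL2H {S, T}; l = T$1$1; m = T$2$2 in
       S \<in> carrier SL2H \<and> T \<in> carrier SL2H \<and> T$2$1 = 0 \<and>
       qre l = qre m \<and> norm l \<le> 1 \<and> 1 \<le> norm m \<and>
       discrete G \<and> \<not> elementary G \<and>
       S_fun l m \<le> eps l \<and>
       norm (S$2$1) * sqrt (norm (tau_0 S T) * norm (t_0 S T))
         = (1 + sqrt (1 - S_fun l m / eps l)) / 2)"

end

theory Submission
  imports Defs
begin

text \<open>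
  Put \<open>p = - c\<inverse> d\<close> and \<open>q = a c\<inverse>\<close>.  Then \<open>\<tau>\<^sub>0 - t\<^sub>0 = \<lambda>(p - q) - (p - q)\<mu>\<close>, and since
  \<open>\<lambda>\<close> and \<open>\<mu>\<close> have the same real part, only their imaginary parts contribute to its norm.  As
  \<open>|c|\<^sup>2 |p - q|\<close> is the right-hand side of the hypothesis, that hypothesis bounds
  \<open>|c|\<^sup>2 |\<tau>\<^sub>0 t\<^sub>0|\<close> strictly by \<open>|\<Im> \<lambda>| + |\<Im> \<mu>| \<le> S(\<lambda>,\<mu>)\<close>.  In an extreme group
  the same quantity is at least \<open>1/4\<close>, whereas \<open>S(\<lambda>,\<mu>) \<le> \<epsilon> \<le> 1/4\<close>.
\<close>

lemma norm_commutator_qim_le: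
  assumes "qre l = qre m"
  shows "norm (l * x - x * m) \<le> norm x * (norm (qim l) + norm (qim m))"
proof -
  \<comment> \<open>The common real part is a central scalar, so it cancels.\<close>
  have "l * x - x * m = qim l * x - x * qim m"
    using assms by (simp add: quat_eq_iff algebra_simps)
  also have "norm \<dots> \<le> norm (qim l * x) + norm (x * qim m)"
    by (rule norm_triangle_ineq4)
  finally show ?thesis
    by (simp add: norm_mult algebra_simps)
qed

text \<open>For \<open>c = 0\<close> both sides are 0, since \<open>inverse 0 = 0\<close>.\<close>

lemma qcnj_eq_scaleR_inverse: "qcnj c = (norm c)\<^sup>2 *\<^sub>R inverse c"
  by (cases "c = 0") (simp_all add: inverse_quat_def norm_quat_sq quat_sumsq_eq_0 quat_eq_iff)

lemma norm_qcnj_mult_add: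
  "norm (qcnj c * d + a * qcnj c) = (norm c)\<^sup>2 * norm (inverse c * d + a * inverse c)"
  by (simp add: qcnj_eq_scaleR_inverse flip: scaleR_add_right)

lemma eps_le: "eps l \<le> 1 / 4"
  by (simp add: eps_def field_simps)

lemma norm_qim_le_S_fun:
  assumes "1 \<le> norm m"
  shows "norm (qim l) + norm (qim m) \<le> S_fun l m"
  using mult_right_mono [OF assms, of "norm (qim l) + norm (qim m)"] by (simp add: S_fun_def)

lemma extreme_lower_bound:
  assumes "extreme S T"
  shows "S_fun (T$1$1) (T$2$2) \<le> (norm (S$2$1))\<^sup>2 * (norm (tau_0 S T) * norm (t_0 S T))"
proof -
  let ?s = "S_fun (T$1$1) (T$2$2)" and ?e = "eps (T$1$1)"
  let ?k = "norm (S$2$1) * sqrt (norm (tau_0 S T) * norm (t_0 S T))"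
  have le: "?s \<le> ?e" and eq: "?k = (1 + sqrt (1 - ?s / ?e)) / 2"
    using assms by (simp_all add: extreme_def Let_def)
  have "0 < ?e"
    by (simp add: eps_def)
  then have "0 \<le> sqrt (1 - ?s / ?e)"
    using le by simp
  \<comment> \<open>Dropping the nonnegative root leaves 1/2, whose square is the largest value of
    \<open>eps\<close>.\<close>
  then have "1 / 2 \<le> ?k"
    by (simp add: eq)
  from power_mono [OF this, of 2] have "1 / 4 \<le> ?k\<^sup>2"
    by (simp add: power_divide)
  then show ?thesis
    using le eps_le [of "T$1$1"] by (simp add: power_mult_distrib)
qed

theorem corollary4p7:
  fixes a b c d lam eta mu tau0 t0 :: quat and S T :: "quat^2^2"
  assumes "S = mat2 a b c d" and "T = mat2 lam eta 0 mu"
    and "S \<in> carrier SL2H" and "T \<in> carrier SL2H"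
    and "qre lam = qre mu" and "norm lam \<le> 1" and "1 \<le> norm mu"
    and "discrete (generate SL2H {S, T})"
    and "\<not> elementary (generate SL2H {S, T})"
    and "tau0 = lam * (- (inverse c * d)) + eta + (inverse c * d) * mu"
    and "t0 = lam * (a * inverse c) + eta - (a * inverse c) * mu"
    and "tau0 * t0 \<noteq> 0"
    and "norm (tau0 - t0) / norm (tau0 * t0) > norm (qcnj c * d + a * qcnj c)"
  shows "\<not> extreme S T"
proof
  assume "extreme S T"
  define x where "x = inverse c * d + a * inverse c"
  define s where "s = norm (qim lam) + norm (qim mu)"
  have "tau_0 S T = tau0" "t_0 S T = t0"
    using assms by (simp_all add: tau_0_def t_0_def Let_def)
  then have "s \<le> (norm c)\<^sup>2 * norm (tau0 * t0)"
    using extreme_lower_bound [OF \<open>extreme S T\<close>] norm_qim_le_S_fun [OF \<open>1 \<le> norm mu\<close>, of lam]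
      assms(1,2)
    by (simp add: s_def norm_mult)
  \<comment> \<open>As \<open>x\<close> may be 0, this step is weak; strictness comes from the
    hypothesis on \<open>tau0 - t0\<close>.\<close>
  then have "norm x * s \<le> norm x * ((norm c)\<^sup>2 * norm (tau0 * t0))"
    by (rule mult_left_mono) simp
  also have "\<dots> = norm (qcnj c * d + a * qcnj c) * norm (tau0 * t0)"
    by (simp add: norm_qcnj_mult_add x_def)
  also have "\<dots> < norm (tau0 - t0)"
    using assms(12,13) by (metis pos_less_divide_eq zero_less_norm_iff)
  \<comment> \<open>\<open>eta\<close> cancels, and \<open>x\<close> is \<open>q - p\<close>, hence
    the minus sign.\<close>
  also have "tau0 - t0 = - (lam * x - x * mu)"
    unfolding assms(10,11) by (simp add: x_def algebra_simps)
  also have "norm \<dots> \<le> norm x * s"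
    unfolding norm_minus_cancel s_def using assms(5) by (rule norm_commutator_qim_le)
  finally show False
    by simp
qed

end
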